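(* Let $(I,g)$ be an $S$-unimodal system and suppose $\mathcal K(g)=\mathcal D^\infty(s)$ for some odd, aperiodic, maximal finite sequence $s\in\{0,1\}^*$. Then $(I,g)$ is not a factor of a finite automaton.
   Context: Unimodal systems. A dynamical system $(I,g)$ on a real interval $I=[a,b]$ is unimodal if $g$ is continuous, $g(a)=g(b)=a$, and there is a critical point $c\in(a,b)$ such that $g$ is (strictly) increasing on $[a,c]$ and (strictly) decreasing on $[c,b]$. It is $S$-unimodal if moreover $g$ has a continuous third derivative, $g''(c)<0$, and $Sg(x)<0$ for all $x\neq c$, where $Sg(x)=\frac{g'''(x)}{g'(x)}-\frac32\left(\frac{g''(x)}{g'(x)}\right)^2$. Sequences. Let $\{0,1\}^*$ be the set of finite words and $\overline{2^*}=\{0,1\}^*\cup\{0,1\}^{\mathbb N}$; $|u|$ is the length of $u$, $u_{|k}=u_0\ldots u_{k-1}$ its prefix of length $k$, $u\sqsubseteq v$ means $u$ is a prefix of $v$, and $\sigma$ deletes the first letter ($\sigma$ of the empty word is empty). For $n<|u|$ put $\tau_n(u)=\sum_{i=0}^n u_i\bmod 2$. Define $u\prec v$ iff there is $k<\min(|u|,|v|)$ with $u_{|k}=v_{|k}$ and $\tau_k(u)<\tau_k(v)$; $u\preceq v$ iff $u\prec v$ or $u\sqsubseteq v$. A sequence $w\in\overline{2^*}$ is maximal if $\sigma^i(w)\preceq w$ for all $i>0$. A finite word is odd if it contains an odd number of $1$s; it is aperiodic if it is not a repetition $t^k$, $k\ge2$, of a shorter word $t$. For a nonempty finite word $s$,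 $\hat s$ is $s$ with its last bit changed, $\mathcal D(s)=s\hat s$, and $\mathcal D^\infty(s)\in\{0,1\}^{\mathbb N}$ is the limit of $\mathcal D^i(s)$ as $i\to\infty$ (each $\mathcal D^i(s)$ is a prefix of $\mathcal D^{i+1}(s)$). Kneading sequence. The itinerary $\mathcal I(x)\in\{0,1\}^{\mathbb N}$ of $x\in I$ is defined recursively by: $g^i(x)<c\Rightarrow\mathcal I(x)_i=0$; $g^i(x)>c\Rightarrow\mathcal I(x)_i=1$; $g^i(x)=c\Rightarrow\mathcal I(x)_i$ is chosen so that $\tau_i(\mathcal I(x))=0$. The kneading sequence is $\mathcal K(g)=\mathcal I(g(c))$. A dynamical system $(X,f)$ is a continuous map $f:X\to X$ of a compact metric space $X$ to itself. $(Y,g)$ is a factor of $(X,f)$ if there is a continuous surjective map $\varphi:X\to Y$ with $g\varphi=\varphi f$. Finite automata. For a finite alphabet $A$ let $A^{\mathbb N}$ be the set of infinite sequences $u=u_0u_1u_2\ldots$ with $u_i\in A$ and metric $2^{-n}$, $n=\inf\{i\ge 0: u_i\ne v_i\}$. Let $\bullet,\sharp$ be symbols not in the alphabets, and define on $A^{\mathbb N}$: $\sigma_\sharp(u_0u_1u_2\ldots)=u_1u_2u_3\ldots$, $\sigma_\bullet(u)=u$, and $\sigma_a(u_0u_1\ldots)=au_0u_1\ldots$ for $a\in A$. Let $T$ be a finite set (of tapes) and for each $t\in T$ let $A_t$ be a finite alphabet. Put $Q=\prod_{t\in T}A_t$, $X=\prod_{t\in T}A_t^{\mathbb N}$ with a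 product metric, and $\pi:X\to Q$, $\pi(u)_t=u_{t0}$. The automaton with transition functions $f_t:Q\to A_t\cup\{\bullet,\sharp\}$ $(t\in T)$ is the dynamical system $(X,f)$ with $f(u)_t=\sigma_{f_t(\pi(u))}(u_t)$ for $u\in X$, $t\in T$. A tape $t$ is an input tape if $f_t(q)\in\{\bullet,\sharp\}$ for all $q\in Q$, and an output tape if $f_t(q)\in A_t\cup\{\bullet\}$ for all $q\in Q$. The automaton is a finite automaton if every tape is an input tape or an output tape. *)

theory Defs
  imports "HOL-Analysis.Analysis" "HOL-Library.Sublist"
begin

section \<open>Unimodal systems\<close>

definition unimodal :: "real \<Rightarrow> real \<Rightarrow> real \<Rightarrow> (real \<Rightarrow> real) \<Rightarrow> bool" where
  "unimodal a b c g \<longleftrightarrow>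
     continuous_on {a..b} g \<and> g ` {a..b} \<subseteq> {a..b} \<and>
     g a = a \<and> g b = a \<and> c \<in> {a<..<b} \<and>
     strict_mono_on {a..c} g \<and> strict_antimono_on {c..b} g"

text \<open>The derivatives are taken relative to \<open>{a..b}\<close>, hence one-sided at the endpoints.
  Since \<open>x / 0 = 0\<close>, the last condition forces \<open>g' x \<noteq> 0\<close> for \<open>x \<noteq> c\<close>, that is,
  the Schwarzian derivative is well defined there.\<close>

definition S_unimodal :: "real \<Rightarrow> real \<Rightarrow> real \<Rightarrow> (real \<Rightarrow> real) \<Rightarrow> bool" where
  "S_unimodal a b c g \<longleftrightarrow> unimodal a b c g \<and>
     (\<exists>g' g'' g'''.
        (\<forall>x\<in>{a..b}. (g has_real_derivative g' x) (at x within {a..b})) \<and>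
        (\<forall>x\<in>{a..b}. (g' has_real_derivative g'' x) (at x within {a..b})) \<and>
        (\<forall>x\<in>{a..b}. (g'' has_real_derivative g''' x) (at x within {a..b})) \<and>
        continuous_on {a..b} g''' \<and>
        g'' c < 0 \<and>
        (\<forall>x\<in>{a..b} - {c}. g''' x / g' x - 3 / 2 * (g'' x / g' x)\<^sup>2 < 0))"


section \<open>Binary sequences\<close>

text \<open>The letters 0 and 1 are \<open>False\<close> and \<open>True\<close>; infinite sequences are functions on \<open>nat\<close>.
  The order is only needed on finite words.\<close>

definition tau :: "(nat \<Rightarrow> bool) \<Rightarrow> nat \<Rightarrow> nat" where
  "tau u n = (\<Sum>i\<le>n. of_bool (u i)) mod 2"

definition word_less :: "bool list \<Rightarrow> bool list \<Rightarrow> bool" where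
  "word_less u v \<longleftrightarrow>
     (\<exists>k < min (length u) (length v). take k u = take k v \<and> tau ((!) u) k < tau ((!) v) k)"

definition word_le :: "bool list \<Rightarrow> bool list \<Rightarrow> bool" where
  "word_le u v \<longleftrightarrow> word_less u v \<or> prefix u v"

definition maximal_word :: "bool list \<Rightarrow> bool" where
  "maximal_word w \<longleftrightarrow> (\<forall>i>0. word_le ((tl ^^ i) w) w)"

definition odd_word :: "bool list \<Rightarrow> bool" where
  "odd_word s \<longleftrightarrow> odd (count_list s True)"

definition aperiodic_word :: "bool list \<Rightarrow> bool" where
  "aperiodic_word s \<longleftrightarrow> \<not> (\<exists>t k. length t < length s \<and> k \<ge> 2 \<and> s = concat (replicate k t))"

definition flip_last :: "bool list \<Rightarrow> bool list" where
  "flip_last s = butlast s @ [\<not> last s]"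

definition doubling :: "bool list \<Rightarrow> bool list" where
  "doubling s = s @ flip_last s"

text \<open>For nonempty \<open>s\<close> the \<open>n\<close>-th iterate has length greater than \<open>n\<close>, so it determines
  the \<open>n\<close>-th letter of the limit; see \<open>doubling_limit_nth\<close>.\<close>

definition doubling_limit :: "bool list \<Rightarrow> nat \<Rightarrow> bool" where
  "doubling_limit s n = ((doubling ^^ n) s) ! n"

lemma length_doubling_iterate:
  assumes "s \<noteq> []"
  shows "n < length ((doubling ^^ n) s)"
proof (induction n)
  case (Suc n)
  then show ?case by (auto simp: doubling_def flip_last_def)
qed (use assms in simp)

lemma prefix_doubling_iterate:
  assumes "i \<le> j"
  shows "prefix ((doubling ^^ i) s) ((doubling ^^ j) s)"
  using assms
proof (induction j rule: dec_induct)
  case (step j)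
  then show ?case
    by (metis doubling_def funpow.simps(2) o_apply prefixI prefix_order.trans)
qed simp

lemma doubling_limit_nth:
  assumes "s \<noteq> []" and "n < length ((doubling ^^ i) s)"
  shows "doubling_limit s n = ((doubling ^^ i) s) ! n"
proof -
  have "n < length ((doubling ^^ n) s)"
    by (rule length_doubling_iterate) fact
  moreover have "prefix ((doubling ^^ i) s) ((doubling ^^ n) s) \<or>
      prefix ((doubling ^^ n) s) ((doubling ^^ i) s)"
    using prefix_doubling_iterate nat_le_linear by blast
  ultimately show ?thesis
    using assms(2) by (auto simp: doubling_limit_def prefix_def nth_append)
qed


section \<open>Kneading sequences\<close>

function itinerary :: "(real \<Rightarrow> real) \<Rightarrow> real \<Rightarrow> real \<Rightarrow> nat \<Rightarrow> bool" where
  "itinerary g c x i =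
     (if (g ^^ i) x < c then False
      else if (g ^^ i) x > c then True
      else odd (\<Sum>j<i. of_bool (itinerary g c x j) :: nat))"
  by pat_completeness blast
termination by (relation "inv_image less_than (\<lambda>(g, c, x, i). i)") simp_all

declare itinerary.simps [simp del]

lemma tau_itinerary_critical:
  assumes "(g ^^ i) x = c"
  shows "tau (itinerary g c x) i = 0"
proof -
  have "{..i} = insert i {..<i}" by auto
  moreover have "itinerary g c x i = odd (\<Sum>j<i. of_bool (itinerary g c x j) :: nat)"
    using assms by (subst itinerary.simps) simp
  ultimately show ?thesis
    by (auto simp: tau_def mod_2_eq_odd)
qed

definition kneading :: "(real \<Rightarrow> real) \<Rightarrow> real \<Rightarrow> nat \<Rightarrow> bool" where
  "kneading g c = itinerary g c (g c)"


section \<open>Factors\<close>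

text \<open>\<open>factor_of Y g X f\<close> says that \<open>(Y, g)\<close> is a factor of \<open>(X, f)\<close>.\<close>

definition factor_of ::
    "'y topology \<Rightarrow> ('y \<Rightarrow> 'y) \<Rightarrow> 'x topology \<Rightarrow> ('x \<Rightarrow> 'x) \<Rightarrow> bool" where
  "factor_of Y g X f \<longleftrightarrow>
     (\<exists>\<phi>. continuous_map X Y \<phi> \<and> \<phi> ` topspace X = topspace Y \<and>
          (\<forall>x\<in>topspace X. g (\<phi> x) = \<phi> (f x)))"


section \<open>Finite automata\<close>

definition seq_space :: "'a set \<Rightarrow> (nat \<Rightarrow> 'a) set" where
  "seq_space A = {u. \<forall>i. u i \<in> A}"

definition seq_dist :: "(nat \<Rightarrow> 'a) \<Rightarrow> (nat \<Rightarrow> 'a) \<Rightarrow> real" where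
  "seq_dist u v = (if u = v then 0 else (1 / 2) ^ (LEAST i. u i \<noteq> v i))"

lemma seq_dist_commute: "seq_dist u v = seq_dist v u"
proof -
  have "(\<lambda>i. u i \<noteq> v i) = (\<lambda>i. v i \<noteq> u i)" by auto
  then show ?thesis by (cases "u = v") (simp_all add: seq_dist_def)
qed

lemma seq_dist_ge:
  assumes "u n \<noteq> v n"
  shows "(1 / 2) ^ n \<le> seq_dist u v"
proof -
  have "(LEAST i. u i \<noteq> v i) \<le> n" using assms by (rule Least_le)
  then have "(1 / 2 :: real) ^ n \<le> (1 / 2) ^ (LEAST i. u i \<noteq> v i)"
    by (intro power_decreasing) simp_all
  moreover have "u \<noteq> v" using assms by blast
  ultimately show ?thesis by (simp add: seq_dist_def)
qed

lemma seq_dist_triangle: "seq_dist u w \<le> seq_dist u v + seq_dist v w"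
proof (cases "u = w")
  case False
  let ?n = "LEAST i. u i \<noteq> w i"
  obtain i where "u i \<noteq> w i" using False by blast
  then have "u ?n \<noteq> w ?n" by (rule LeastI)
  then have "u ?n \<noteq> v ?n \<or> v ?n \<noteq> w ?n" by metis
  then have "(1 / 2) ^ ?n \<le> seq_dist u v \<or> (1 / 2) ^ ?n \<le> seq_dist v w"
    using seq_dist_ge[of u ?n v] seq_dist_ge[of v ?n w] by blast
  moreover have "0 \<le> seq_dist u v" "0 \<le> seq_dist v w" by (simp_all add: seq_dist_def)
  moreover have "seq_dist u w = (1 / 2) ^ ?n" using False by (simp add: seq_dist_def)
  ultimately show ?thesis by linarith
qed (simp add: seq_dist_def)

lemma Metric_space_seq: "Metric_space (seq_space A) seq_dist"
  by (rule Metric_space.intro)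
    (simp_all add: seq_dist_commute seq_dist_triangle, simp_all add: seq_dist_def)

text \<open>\<open>Stay\<close> is the symbol \<open>\<bullet>\<close> and \<open>Pop\<close> is the symbol \<open>\<sharp>\<close>.\<close>

datatype 'a tape_op = Push 'a | Stay | Pop

fun tape_step :: "'a tape_op \<Rightarrow> (nat \<Rightarrow> 'a) \<Rightarrow> nat \<Rightarrow> 'a" where
  "tape_step (Push x) u = case_nat x u"
| "tape_step Stay u = u"
| "tape_step Pop u = (\<lambda>i. u (Suc i))"

text \<open>The tapes form the set \<open>T\<close>, the alphabet of \<open>t\<close> is \<open>A t\<close>, and \<open>\<delta> t\<close> is the
  transition function of \<open>t\<close>.\<close>

definition states :: "'t set \<Rightarrow> ('t \<Rightarrow> 'a set) \<Rightarrow> ('t \<Rightarrow> 'a) set" where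
  "states T A = (\<Pi>\<^sub>E t\<in>T. A t)"

definition automaton_space :: "'t set \<Rightarrow> ('t \<Rightarrow> 'a set) \<Rightarrow> ('t \<Rightarrow> nat \<Rightarrow> 'a) topology" where
  "automaton_space T A =
     product_topology (\<lambda>t. Metric_space.mtopology (seq_space (A t)) seq_dist) T"

definition automaton_map ::
    "'t set \<Rightarrow> ('t \<Rightarrow> ('t \<Rightarrow> 'a) \<Rightarrow> 'a tape_op) \<Rightarrow> ('t \<Rightarrow> nat \<Rightarrow> 'a) \<Rightarrow> 't \<Rightarrow> nat \<Rightarrow> 'a" where
  "automaton_map T \<delta> u = (\<lambda>t\<in>T. tape_step (\<delta> t (\<lambda>r\<in>T. u r 0)) (u t))"

lemma topspace_automaton_space:
  "topspace (automaton_space T A) = (\<Pi>\<^sub>E t\<in>T. seq_space (A t))"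
  by (simp add: automaton_space_def Metric_space.topspace_mtopology[OF Metric_space_seq])

definition automaton ::
    "'t set \<Rightarrow> ('t \<Rightarrow> 'a set) \<Rightarrow> ('t \<Rightarrow> ('t \<Rightarrow> 'a) \<Rightarrow> 'a tape_op) \<Rightarrow> bool" where
  "automaton T A \<delta> \<longleftrightarrow> finite T \<and> (\<forall>t\<in>T. finite (A t)) \<and>
     (\<forall>t\<in>T. \<forall>q\<in>states T A. \<delta> t q \<in> Push ` A t \<union> {Stay, Pop})"

definition input_tape ::
    "'t set \<Rightarrow> ('t \<Rightarrow> 'a set) \<Rightarrow> ('t \<Rightarrow> ('t \<Rightarrow> 'a) \<Rightarrow> 'a tape_op) \<Rightarrow> 't \<Rightarrow> bool" where
  "input_tape T A \<delta> t \<longleftrightarrow> (\<forall>q\<in>states T A. \<delta> t q \<in> {Stay, Pop})"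

definition output_tape ::
    "'t set \<Rightarrow> ('t \<Rightarrow> 'a set) \<Rightarrow> ('t \<Rightarrow> ('t \<Rightarrow> 'a) \<Rightarrow> 'a tape_op) \<Rightarrow> 't \<Rightarrow> bool" where
  "output_tape T A \<delta> t \<longleftrightarrow> (\<forall>q\<in>states T A. \<delta> t q \<in> Push ` A t \<union> {Stay})"

definition finite_automaton ::
    "'t set \<Rightarrow> ('t \<Rightarrow> 'a set) \<Rightarrow> ('t \<Rightarrow> ('t \<Rightarrow> 'a) \<Rightarrow> 'a tape_op) \<Rightarrow> bool" where
  "finite_automaton T A \<delta> \<longleftrightarrow> automaton T A \<delta> \<and>
     (\<forall>t\<in>T. input_tape T A \<delta> t \<or> output_tape T A \<delta> t)"

lemma automaton_map_in_space:
  assumes "automaton T A \<delta>" and "u \<in> topspace (automaton_space T A)"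
  shows "automaton_map T \<delta> u \<in> topspace (automaton_space T A)"
  unfolding topspace_automaton_space automaton_map_def
proof (rule restrict_PiE_iff[THEN iffD2], intro ballI)
  fix t assume t: "t \<in> T"
  let ?q = "\<lambda>r\<in>T. u r 0"
  have u: "u r i \<in> A r" if "r \<in> T" for r i
    using assms(2) that by (auto simp: topspace_automaton_space seq_space_def PiE_iff)
  then have "?q \<in> states T A" by (simp add: states_def)
  then have "\<delta> t ?q \<in> Push ` A t \<union> {Stay, Pop}"
    using assms(1) t by (auto simp: automaton_def)
  then show "tape_step (\<delta> t ?q) (u t) \<in> seq_space (A t)"
    using u[OF t] by (auto simp: seq_space_def split: nat.split)
qed

end

theory Submission
  imports Defs
begin

text \<open>In a finite automaton, replace the far tail of every tape by a constant. The heads of the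
  input tapes then become eventually constant, so the state evolves by a self-map of a finite set,
  and \<open>f\<^sup>n\<^sup>M\<close> converges at the modified point, where \<open>M\<close> depends only on the automaton. Hence in a
  factor \<open>(I, g)\<close> densely many points converge under \<open>g\<^sup>M\<close> to a fixed point of \<open>g\<^sup>M\<close>.

  On the other hand, let \<open>m = |s| 2\<^sup>k\<close>. Off the positions congruent to \<open>m - 1\<close> the sequence
  \<open>\<D>\<^sup>\<infinity>(s)\<close> is \<open>m\<close>-periodic, so the convex hull of each residue class mod \<open>m\<close> of the critical orbit,
  except for that of \<open>c\<close> itself, lies on one side of \<open>c\<close>, and these hulls are mapped into each other
  cyclically. A fixed point of \<open>g\<^sup>M\<close> in the hull around \<open>c\<close> has the same first \<open>m - 1\<close> sides as the
  critical value, which makes the prefix of length \<open>m - 1\<close> of \<open>\<D>\<^sup>\<infinity>(s)\<close> periodic with period \<open>M\<close>.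
  Since \<open>k\<close> is arbitrary while \<open>\<D>\<^sup>\<infinity>(s)\<close> is not periodic, this is impossible.\<close>

section \<open>The doubling limit\<close>

lemma length_doubling_power: "s \<noteq> [] \<Longrightarrow> length ((doubling ^^ k) s) = length s * 2 ^ k"
proof (induction k)
  case (Suc k)
  have "(doubling ^^ k) s \<noteq> []"
    using length_doubling_iterate[OF Suc.prems, of k] by auto
  with Suc show ?case by (simp add: doubling_def flip_last_def)
qed simp

lemma nth_doubling:
  assumes "u \<noteq> []" and "i < 2 * length u"
  shows "doubling u ! i = (if i = 2 * length u - 1 then \<not> last u else u ! (i mod length u))"
proof (cases "i < length u")
  case False
  then have "i mod length u = i - length u"
    using assms by (simp add: mod_if)
  with False assms show ?thesis
    by (auto simp: doubling_def flip_last_def nth_append nth_butlast)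
qed (use assms in \<open>auto simp: doubling_def nth_append\<close>)

text \<open>Each doubling repeats the word and changes only its last letter, whose position is
  congruent to \<open>length u - 1\<close> modulo \<open>length u\<close>. All other residues
  inherit the letters of \<open>u\<close>.\<close>

lemma nth_doubling_power:
  assumes "u \<noteq> []" and "i < length ((doubling ^^ n) u)" and "i mod length u \<noteq> length u - 1"
  shows "((doubling ^^ n) u) ! i = u ! (i mod length u)"
  using assms(2,3)
proof (induction n arbitrary: i)
  case (Suc n)
  let ?v = "(doubling ^^ n) u"
  have len: "length ?v = length u * 2 ^ n"
    by (rule length_doubling_power) fact
  have "?v \<noteq> []" using length_doubling_iterate[OF assms(1), of n] by auto
  have i: "i < 2 * length ?v"
    using Suc.prems(1) length_doubling_power[OF assms(1), of "Suc n"] len by simp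
  have "i \<noteq> 2 * length ?v - 1"
  proof
    assume "i = 2 * length ?v - 1"
    also have "\<dots> = (length u - 1) + length u * (2 * 2 ^ n - 1)"
    proof -
      have "length u * (2 * 2 ^ n - 1) = length u * (2 * 2 ^ n) - length u"
        by (simp add: diff_mult_distrib2)
      moreover have "length u * 1 \<le> length u * (2 * 2 ^ n)" by (intro mult_le_mono2) simp
      moreover have "length u > 0" using assms(1) by simp
      moreover have "2 * length ?v = length u * (2 * 2 ^ n)" by (simp add: len)
      ultimately show ?thesis by linarith
    qed
    finally show False using Suc.prems(2) assms(1) by simp
  qed
  then have "doubling ?v ! i = ?v ! (i mod length ?v)"
    using nth_doubling[OF \<open>?v \<noteq> []\<close> i] by simp
  also have "\<dots> = u ! (i mod length ?v mod length u)"
    using Suc.IH[of "i mod length ?v"] Suc.prems(2) assms(1) by (simp add: len mod_mod_cancel)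
  finally show ?case by (simp add: len mod_mod_cancel)
qed simp

text \<open>Every word \<open>(doubling ^^ k) s\<close> generates the same limit as
  \<open>s\<close>, so periodicity off the last residue holds at every scale
  \<open>m\<close>.\<close>

lemma doubling_limit_mod:
  assumes "s \<noteq> []" and m: "m = length s * 2 ^ k" and "i mod m \<noteq> m - 1"
  shows "doubling_limit s i = doubling_limit s (i mod m)"
proof -
  let ?u = "(doubling ^^ k) s"
  have u: "?u \<noteq> []" using length_doubling_iterate[OF assms(1), of k] by auto
  have len: "length ?u = m" using length_doubling_power[OF assms(1)] m by simp
  have i: "i < length ((doubling ^^ i) ?u)" by (rule length_doubling_iterate) fact
  have "doubling_limit s i = ((doubling ^^ i) ?u) ! i"
    using doubling_limit_nth[OF assms(1), of i "i + k"] i by (simp add: funpow_add)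
  also have "\<dots> = ?u ! (i mod m)"
    using nth_doubling_power[OF u i] assms(3) len by simp
  also have "\<dots> = doubling_limit s (i mod m)"
    using doubling_limit_nth[OF assms(1), of "i mod m" k] u len by fastforce
  finally show ?thesis .
qed

text \<open>These positions hold the last letters of the two halves of
  \<open>(doubling ^^ Suc k) s\<close>.\<close>

lemma doubling_limit_flip:
  assumes "s \<noteq> []" and m: "m = length s * 2 ^ k"
  shows "doubling_limit s (2 * m - 1) = (\<not> doubling_limit s (m - 1))"
proof -
  let ?u = "(doubling ^^ k) s"
  have u: "?u \<noteq> []" using length_doubling_iterate[OF assms(1), of k] by auto
  have len: "length ?u = m" using length_doubling_power[OF assms(1)] m by simp
  have "m > 0" using assms by simp
  have "length ((doubling ^^ Suc k) s) = 2 * m"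
    using length_doubling_power[OF assms(1), of "Suc k"] m by simp
  then have "doubling_limit s (2 * m - 1) = doubling ?u ! (2 * m - 1)"
    using doubling_limit_nth[OF assms(1), of "2 * m - 1" "Suc k"] \<open>m > 0\<close> by simp
  also have "\<dots> = (\<not> last ?u)"
    using nth_doubling[OF u, of "2 * m - 1"] len \<open>m > 0\<close> by simp
  also have "last ?u = doubling_limit s (m - 1)"
    using doubling_limit_nth[OF assms(1), of "m - 1" k] u len \<open>m > 0\<close> by (simp add: last_conv_nth)
  finally show ?thesis .
qed

text \<open>Write \<open>M = 2 ^ e * q\<close> with \<open>q\<close> odd and put
  \<open>m = length s * 2 ^ e\<close>. A shift by \<open>length s * M\<close> is a shift by an odd
  multiple of \<open>m\<close>, so it takes position \<open>2 * m - 1\<close> to the residue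
  \<open>m - 1\<close> modulo \<open>2 * m\<close>. That residue is not the exceptional one at scale
  \<open>2 * m\<close>, so periodicity would equate the letters at \<open>2 * m - 1\<close> and
  \<open>m - 1\<close>, which differ.\<close>

lemma doubling_limit_not_periodic:
  assumes "s \<noteq> []" and "M > 0"
  shows "\<exists>i. doubling_limit s (i + M) \<noteq> doubling_limit s i"
proof (rule ccontr)
  assume "\<not> ?thesis"
  then have per: "doubling_limit s (i + M) = doubling_limit s i" for i by blast
  have per_mult: "doubling_limit s (i + n * M) = doubling_limit s i" for i n
  proof (induction n)
    case (Suc n)
    then show ?case using per[of "i + n * M"] by (simp add: add.assoc add.commute[of M])
  qed simp
  obtain e q where M: "M = 2 ^ e * q" and "odd q"
    using multiplicity_decompose'[of M 2] assms(2) by (metis not_gr_zero not_is_unit_0 odd_one)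
  define m where "m = length s * 2 ^ e"
  have "m > 0" using assms(1) by (simp add: m_def)
  obtain l where q: "q = 2 * l + 1" using \<open>odd q\<close> by (rule oddE)
  have eq: "2 * m - 1 + length s * M = (m - 1) + (l + 1) * (2 * m)"
    using \<open>m > 0\<close> by (simp add: M q m_def algebra_simps)
  have "(m - 1) mod (2 * m) = m - 1" using \<open>m > 0\<close> by simp
  then have "((m - 1) + (l + 1) * (2 * m)) mod (2 * m) = m - 1"
    by (metis mod_mult_self1)
  moreover have "2 * m = length s * 2 ^ Suc e" by (simp add: m_def)
  moreover have "m - 1 \<noteq> 2 * m - 1" using \<open>m > 0\<close> by simp
  ultimately have "doubling_limit s ((m - 1) + (l + 1) * (2 * m)) = doubling_limit s (m - 1)"
    using doubling_limit_mod[OF assms(1), of "2 * m" "Suc e" "(m - 1) + (l + 1) * (2 * m)"]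
    by (simp only: not_False_eq_True)
  then have "doubling_limit s (2 * m - 1) = doubling_limit s (m - 1)"
    using per_mult[of "2 * m - 1" "length s"] by (simp only: eq)
  then show False
    using doubling_limit_flip[OF assms(1) m_def] by blast
qed

section \<open>Unimodal maps\<close>

lemma itinerary_le: "\<not> itinerary g c x i \<Longrightarrow> (g ^^ i) x \<le> c"
  by (subst (asm) itinerary.simps) (auto split: if_splits)

lemma itinerary_ge: "itinerary g c x i \<Longrightarrow> (g ^^ i) x \<ge> c"
  by (subst (asm) itinerary.simps) (auto split: if_splits)

text \<open>The orbit of \<open>g c\<close> has period \<open>M\<close>, so only visits to
  \<open>c\<close> need care: there a letter is the parity of all earlier ones, whence the strong
  induction. The parity is preserved because the first \<open>M\<close> letters have even
  sum.\<close>

lemma kneading_periodic: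
  assumes "(g ^^ M) c = c" and "M > 0"
  shows "kneading g c (i + M) = kneading g c i"
proof (induction i rule: less_induct)
  case (less i)
  let ?K = "kneading g c"
  \<comment> \<open>At index \<open>M - 1\<close> the orbit visits \<open>c\<close>, where the
    letter is chosen to make the sum even.\<close>
  have "(g ^^ (M - 1)) (g c) = c"
    using assms by (metis Suc_pred' comp_apply funpow_Suc_right)
  then have "tau ?K (M - 1) = 0"
    by (simp add: kneading_def tau_itinerary_critical)
  moreover have "{..M - 1} = {..<M}" using assms(2) by auto
  ultimately have evn: "even (\<Sum>j<M. of_bool (?K j) :: nat)"
    by (simp add: tau_def mod_2_eq_odd)
  have "(\<Sum>j<i + M. of_bool (?K j) :: nat) = (\<Sum>j<M. of_bool (?K j)) + (\<Sum>j<i. of_bool (?K (j + M)))"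
    by (induction i) simp_all
  also have "(\<Sum>j<i. of_bool (?K (j + M)) :: nat) = (\<Sum>j<i. of_bool (?K j))"
    using less by (intro sum.cong) auto
  finally have "odd (\<Sum>j<i + M. of_bool (?K j) :: nat) = odd (\<Sum>j<i. of_bool (?K j) :: nat)"
    using evn by simp
  moreover have "(g ^^ (i + M)) (g c) = (g ^^ i) (g c)"
    using assms(1) by (simp add: funpow_add funpow_swap1[symmetric])
  ultimately show ?case
    unfolding kneading_def by (subst (1 2) itinerary.simps) simp
qed

section \<open>Closed convex hulls and their images under a unimodal map\<close>

definition order_hull :: "real set \<Rightarrow> real set" where
  "order_hull S = {Inf S..Sup S}"

lemma closure_subset_order_hull:
  assumes "S \<subseteq> {a..b}"
  shows "closure S \<subseteq> order_hull S"
proof (rule closure_minimal)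
  have "bdd_below S" "bdd_above S"
    using assms bdd_below_mono[of "{a..b}"] bdd_above_mono[of "{a..b}"] by auto
  then show "S \<subseteq> order_hull S"
    by (auto simp: order_hull_def intro: cInf_lower cSup_upper)
qed (simp add: order_hull_def)

lemma order_hull_subset:
  assumes "S \<noteq> {}" and "S \<subseteq> {a..b}"
  shows "order_hull S \<subseteq> {a..b}"
proof -
  have "a \<le> Inf S" using assms by (intro cInf_greatest) auto
  moreover have "Sup S \<le> b" using assms by (intro cSup_least) auto
  ultimately show ?thesis by (auto simp: order_hull_def)
qed

lemma order_hull_mono:
  assumes "S \<noteq> {}" and "S \<subseteq> S'" and "S' \<subseteq> {a..b}"
  shows "order_hull S \<subseteq> order_hull S'"
proof -
  have "bdd_below S'" "bdd_above S'"
    using assms bdd_below_mono[of "{a..b}"] bdd_above_mono[of "{a..b}"] by auto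
  with assms show ?thesis
    using cInf_superset_mono[of S S'] cSup_subset_mono[of S S'] by (auto simp: order_hull_def)
qed

text \<open>On one side of \<open>c\<close> the map is monotone, so its values on the hull lie
  between those at the ends. A hull containing \<open>c\<close> also takes the value
  \<open>g c\<close>, which \<open>c \<in> S\<close> puts among the values on
  \<open>S\<close>.\<close>

lemma image_order_hull:
  assumes g: "unimodal a b c g" and S: "S \<noteq> {}" "S \<subseteq> {a..b}"
    and side: "S \<subseteq> {a..c} \<or> S \<subseteq> {c..b} \<or> c \<in> S"
  shows "g ` order_hull S \<subseteq> order_hull (g ` S)"
proof
  fix y assume "y \<in> g ` order_hull S"
  then obtain z where y: "y = g z" and z: "z \<in> order_hull S" by blast
  have bdd: "bdd_below S" "bdd_above S"
    using S bdd_below_mono[of "{a..b}"] bdd_above_mono[of "{a..b}"] by auto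
  have Sab: "order_hull S \<subseteq> {a..b}" using order_hull_subset S by blast
  have gS: "g ` S \<subseteq> {a..b}" using g S by (auto simp: unimodal_def)
  have clos: "closure S \<subseteq> {a..b}" using S closure_minimal by blast
  \<comment> \<open>\<open>S\<close> may miss its infimum and supremum, so the values there are
    bounded by continuity on the closure.\<close>
  have "continuous_on (closure S) g"
    using g clos continuous_on_subset unfolding unimodal_def by blast
  then have "g ` closure S \<subseteq> order_hull (g ` S)"
  proof (rule image_closure_subset)
    show "closed (order_hull (g ` S))" by (simp add: order_hull_def)
    show "g ` S \<subseteq> order_hull (g ` S)"
      using closure_subset closure_subset_order_hull[OF gS] by (rule subset_trans)
  qed
  then have cl: "x \<in> closure S \<Longrightarrow> Inf (g ` S) \<le> g x \<and> g x \<le> Sup (g ` S)" for x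
    by (auto simp: order_hull_def)
  have ends: "Inf S \<in> closure S" "Sup S \<in> closure S"
    using closure_contains_Inf[OF S(1) bdd(1)] closure_contains_Sup[OF S(1) bdd(2)] by simp_all
  have incr: "g x \<le> g x'" if "a \<le> x" "x \<le> x'" "x' \<le> c" for x x'
    using g that by (auto simp: unimodal_def dest!: strict_mono_on_imp_mono_on elim: mono_onD)
  have decr: "g x' \<le> g x" if "c \<le> x" "x \<le> x'" "x' \<le> b" for x x'
    using g that by (cases "x = x'") (auto simp: unimodal_def monotone_on_def less_imp_le)
  have zz: "Inf S \<le> z" "z \<le> Sup S" using z by (auto simp: order_hull_def)
  have mem: "a \<le> Inf S" "Sup S \<le> b"
    using ends clos by auto
  consider "S \<subseteq> {a..c}" | "S \<subseteq> {c..b}" | "c \<in> S" using side by blast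
  then have "Inf (g ` S) \<le> g z \<and> g z \<le> Sup (g ` S)"
  proof cases
    case 1
    then have "Sup S \<le> c" using S by (intro cSup_least) auto
    then show ?thesis
      using incr[of "Inf S" z] incr[of z "Sup S"] cl ends mem zz by fastforce
  next
    case 2
    then have "c \<le> Inf S" using S by (intro cInf_greatest) auto
    then show ?thesis
      using decr[of "Inf S" z] decr[of z "Sup S"] cl ends mem zz by fastforce
  next
    case 3
    then have "c \<in> closure S" using closure_subset by blast
    then show ?thesis
      using incr[of "Inf S" z] incr[of z c] decr[of c z] decr[of z "Sup S"] cl ends mem zz
      by (cases "z \<le> c") fastforce+
  qed
  then show "y \<in> order_hull (g ` S)" by (simp add: y order_hull_def)
qed

section \<open>Residue classes of the critical orbit\<close>

definition orbit_class :: "(real \<Rightarrow> real) \<Rightarrow> real \<Rightarrow> nat \<Rightarrow> nat \<Rightarrow> real set" where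
  "orbit_class g c m j = range (\<lambda>n. (g ^^ (j + n * m)) c)"

lemma funpow_mem:
  assumes "g ` S \<subseteq> S" and "x \<in> S"
  shows "(g ^^ n) x \<in> S"
  using assms by (induction n) auto

lemma image_orbit_class: "g ` orbit_class g c m j = orbit_class g c m (Suc j)"
  by (simp add: orbit_class_def image_image)

text \<open>Indices are not reduced modulo \<open>m\<close>, so \<open>g\<close> raises them by
  exactly one. This inclusion closes the cycle of classes.\<close>

lemma orbit_class_add_subset: "orbit_class g c m (j + m) \<subseteq> orbit_class g c m j"
  unfolding orbit_class_def
proof
  fix x assume "x \<in> range (\<lambda>n. (g ^^ (j + m + n * m)) c)"
  then obtain n where "x = (g ^^ (j + Suc n * m)) c" by (auto simp: add.assoc)
  then show "x \<in> range (\<lambda>n. (g ^^ (j + n * m)) c)" by blast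
qed

lemma orbit_class_subset:
  assumes "unimodal a b c g"
  shows "orbit_class g c m j \<subseteq> {a..b}"
  using assms funpow_mem[of g "{a..b}" c] by (auto simp: orbit_class_def unimodal_def)

text \<open>The points of this class have indices \<open>j + n * m\<close> in the orbit of
  \<open>g c\<close>, and these positions all carry the same letter. The bound on \<open>j\<close>
  omits the residue \<open>m - 1\<close>, which leads to the class of \<open>c\<close>. The sides
  are closed since the orbit may return to \<open>c\<close>.\<close>

lemma orbit_class_side:
  assumes g: "unimodal a b c g"
    and K: "\<And>i. i mod m \<noteq> m - 1 \<Longrightarrow> kneading g c i = kneading g c (i mod m)"
    and j: "Suc j < m"
  shows "orbit_class g c m (Suc j) \<subseteq> (if kneading g c j then {c..b} else {a..c})"
proof
  fix x assume x: "x \<in> orbit_class g c m (Suc j)"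
  then obtain n where n: "x = (g ^^ (j + n * m)) (g c)"
    by (auto simp: orbit_class_def funpow_swap1)
  have "kneading g c (j + n * m) = kneading g c j"
    using K[of "j + n * m"] j by simp
  then show "x \<in> (if kneading g c j then {c..b} else {a..c})"
    using itinerary_le[of g c "g c" "j + n * m"] itinerary_ge[of g c "g c" "j + n * m"]
      x orbit_class_subset[OF g, of m "Suc j"] by (auto simp: n kneading_def)
qed

text \<open>Class \<open>0\<close> contains \<open>c\<close> and the other classes below
  \<open>m\<close> lie on one side of it, so \<open>image_order_hull\<close> applies at every
  step.\<close>

lemma funpow_order_hull:
  assumes g: "unimodal a b c g" and "m > 0"
    and K: "\<And>i. i mod m \<noteq> m - 1 \<Longrightarrow> kneading g c i = kneading g c (i mod m)"
    and z: "z \<in> order_hull (orbit_class g c m 0)"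
  shows "(g ^^ i) z \<in> order_hull (orbit_class g c m (i mod m))"
proof (induction i)
  case (Suc i)
  let ?j = "i mod m"
  have ne: "orbit_class g c m j \<noteq> {}" for j by (simp add: orbit_class_def)
  have "orbit_class g c m ?j \<subseteq> {a..c} \<or> orbit_class g c m ?j \<subseteq> {c..b} \<or> c \<in> orbit_class g c m ?j"
  proof (cases ?j)
    case 0
    then have "c = (g ^^ (?j + 0 * m)) c" by simp
    then have "c \<in> orbit_class g c m ?j" unfolding orbit_class_def by (rule range_eqI)
    then show ?thesis by blast
  next
    case (Suc j)
    then have "Suc j < m" using \<open>m > 0\<close> by (metis mod_less_divisor)
    from orbit_class_side[OF g K this] show ?thesis
      using Suc by (simp split: if_splits)
  qed
  from image_order_hull[OF g ne orbit_class_subset[OF g] this] Suc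
  have *: "(g ^^ Suc i) z \<in> order_hull (orbit_class g c m (Suc ?j))"
    by (auto simp: image_orbit_class)
  show ?case
  proof (cases "Suc ?j = m")
    case True
    then have "Suc i mod m = 0" by (simp add: mod_Suc)
    moreover have "orbit_class g c m m \<subseteq> orbit_class g c m 0"
      using orbit_class_add_subset[of g c m 0] by simp
    ultimately show ?thesis
      using * True order_hull_mono[OF ne _ orbit_class_subset[OF g], of m m 0] by auto
  next
    case False
    then show ?thesis using * by (simp add: mod_Suc)
  qed
qed (use z in simp)

text \<open>The orbit of \<open>z\<close> follows the hulls, hence the sides given by the kneading
  letters below index \<open>m - 1\<close>. It avoids \<open>c\<close>, so its sides determine these
  letters, which inherit the period \<open>M\<close> of \<open>z\<close>.\<close>

lemma kneading_periodic_of_fixed_point: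
  assumes g: "unimodal a b c g" and "m > 0"
    and K: "\<And>i. i mod m \<noteq> m - 1 \<Longrightarrow> kneading g c i = kneading g c (i mod m)"
    and z: "z \<in> order_hull (orbit_class g c m 0)"
    and fp: "(g ^^ M) z = z" and c: "(g ^^ M) c \<noteq> c" and i: "Suc (i + M) < m"
  shows "kneading g c (i + M) = kneading g c i"
proof -
  have per: "(g ^^ (n + M)) z = (g ^^ n) z" for n
    by (simp add: funpow_add fp)
  \<comment> \<open>A visit to \<open>c\<close> would make \<open>c\<close> itself a fixed point of
    \<open>g ^^ M\<close>.\<close>
  have ne: "(g ^^ n) z \<noteq> c" for n
    using per[of n] c by (metis add.commute comp_apply funpow_add)
  \<comment> \<open>Kneading letters start at \<open>g c\<close>, so letter \<open>n\<close> is
    compared with iterate \<open>Suc n\<close> of \<open>z\<close>.\<close>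
  have side: "kneading g c n \<longleftrightarrow> (g ^^ Suc n) z > c" if "Suc n < m" for n
  proof -
    let ?S = "orbit_class g c m (Suc n)"
    have "(g ^^ Suc n) z \<in> order_hull ?S"
      using funpow_order_hull[OF g \<open>m > 0\<close> K z, of "Suc n"] that by simp
    moreover have "?S \<noteq> {}" by (simp add: orbit_class_def)
    ultimately have "(g ^^ Suc n) z \<in> (if kneading g c n then {c..b} else {a..c})"
      using order_hull_subset[of ?S c b] order_hull_subset[of ?S a c]
        orbit_class_side[OF g K that] by (auto split: if_splits)
    then show ?thesis using ne[of "Suc n"] by (auto split: if_splits)
  qed
  show ?thesis
    using side[of "i + M"] side[of i] per[of "Suc i"] i by simp
qed

section \<open>Finite automata\<close>

lemma limitin_automaton_space:
  assumes x: "\<And>n. x n \<in> topspace (automaton_space T A)"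
    and z: "z \<in> topspace (automaton_space T A)"
    and conv: "\<And>t i. t \<in> T \<Longrightarrow> \<forall>\<^sub>F n in sequentially. x n t i = z t i"
  shows "limitin (automaton_space T A) x z sequentially"
  unfolding automaton_space_def limitin_componentwise
proof (intro conjI ballI)
  show "z \<in> extensional T" using z by (simp add: topspace_automaton_space PiE_iff)
  show "\<forall>\<^sub>F n in sequentially. x n \<in> topspace
      (product_topology (\<lambda>t. Metric_space.mtopology (seq_space (A t)) seq_dist) T)"
    using x by (simp add: automaton_space_def)
  fix t assume t: "t \<in> T"
  have mem: "z t \<in> seq_space (A t)" "x n t \<in> seq_space (A t)" for n
    using x[of n] z t by (auto simp: topspace_automaton_space PiE_iff)
  show "limitin (Metric_space.mtopology (seq_space (A t)) seq_dist) (\<lambda>n. x n t) (z t) sequentially"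
    unfolding Metric_space.limitin_metric[OF Metric_space_seq]
  proof (intro conjI allI impI mem)
    fix \<epsilon> :: real assume "\<epsilon> > 0"
    obtain N where N: "(1 / 2) ^ N < \<epsilon>"
      using real_arch_pow_inv[OF \<open>\<epsilon> > 0\<close>, of "1 / 2"] by auto
    \<comment> \<open>Agreement on the finitely many cells up to \<open>N\<close> already forces the
      distance below \<epsilon>.\<close>
    have "\<forall>\<^sub>F n in sequentially. \<forall>i\<in>{..N}. x n t i = z t i"
      using conv[OF t] by (subst eventually_ball_finite_distrib) auto
    then show "\<forall>\<^sub>F n in sequentially. x n t \<in> seq_space (A t) \<and> seq_dist (x n t) (z t) < \<epsilon>"
    proof (rule eventually_mono, intro conjI mem)
      fix n assume eq: "\<forall>i\<in>{..N}. x n t i = z t i"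
      show "seq_dist (x n t) (z t) < \<epsilon>"
      proof (cases "x n t = z t")
        case False
        then have "\<exists>i. x n t i \<noteq> z t i" by auto
        then have "x n t (LEAST i. x n t i \<noteq> z t i) \<noteq> z t (LEAST i. x n t i \<noteq> z t i)"
          by (rule LeastI_ex)
        then have "N \<le> (LEAST i. x n t i \<noteq> z t i)"
          using eq by (meson atMost_iff nle_le)
        then have "(1 / 2 :: real) ^ (LEAST i. x n t i \<noteq> z t i) \<le> (1 / 2) ^ N"
          by (intro power_decreasing) simp_all
        with N have "(1 / 2 :: real) ^ (LEAST i. x n t i \<noteq> z t i) < \<epsilon>" by linarith
        with False show ?thesis by (simp add: seq_dist_def)
      qed (use \<open>\<epsilon> > 0\<close> in \<open>simp add: seq_dist_def\<close>)
    qed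
  qed
qed

section \<open>Eventual behaviour of single tapes and of the state\<close>

lemma eventually_constant_comp_mono:
  fixes p :: "nat \<Rightarrow> nat"
  assumes p: "\<And>k. p k \<le> p (Suc k)" and w: "\<And>i. i \<ge> N \<Longrightarrow> w i = d"
  shows "\<exists>e. \<forall>\<^sub>F k in sequentially. w (p k) = e"
proof -
  have mono: "p k \<le> p l" if "k \<le> l" for k l
    using p that by (rule lift_Suc_mono_le)
  show ?thesis
  proof (cases "\<exists>k. p k \<ge> N")
    case True
    then obtain k where "p k \<ge> N" by blast
    then have "w (p l) = d" if "l \<ge> k" for l
      using mono[OF that] w by force
    then show ?thesis by (auto simp: eventually_sequentially)
  next
    \<comment> \<open>A bounded nondecreasing \<open>p\<close> attains its maximum and stays there;
      the letter read then may differ from \<open>d\<close>.\<close>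
    case False
    then have fin: "finite (range p)"
      by (intro finite_subset[of "range p" "{..<N}"]) (auto simp: not_le)
    have "Max (range p) \<in> range p" using fin by (intro Max_in) auto
    then obtain k where k: "Max (range p) = p k" by auto
    have "p l = p k" if "l \<ge> k" for l
      using mono[OF that] Max_ge[OF fin, of "p l"] k by auto
    then have "\<forall>l\<ge>k. w (p l) = w (p k)" by (intro allI impI arg_cong[of _ _ w])
    then show ?thesis unfolding eventually_sequentially by blast
  qed
qed

text \<open>By pigeonhole a value recurs after at most \<open>card S\<close> steps. Every such gap
  divides \<open>fact (card S)\<close>, so the factorial is a period independent of
  \<open>q\<close>, \<open>L\<close> and \<open>F\<close>.\<close>

lemma iterates_eventually_periodic:
  assumes "finite S" and S: "\<And>k. q k \<in> S" and q: "\<And>k. k \<ge> L \<Longrightarrow> q (Suc k) = F (q k)"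
  shows "\<forall>\<^sub>F k in sequentially. q (k + fact (card S)) = q k"
proof -
  have "\<not> inj_on q {L..L + card S}"
  proof
    assume "inj_on q {L..L + card S}"
    then have "card {L..L + card S} \<le> card S"
      using S \<open>finite S\<close> by (intro card_inj_on_le) auto
    then show False by simp
  qed
  then obtain i j where ij: "L \<le> i" "i < j" "j \<le> L + card S" "q i = q j"
    unfolding inj_on_def by (metis atLeastAtMost_iff nat_neq_iff)
  define r where "r = j - i"
  have r: "r > 0" "r \<le> card S" "q (i + r) = q i" using ij by (auto simp: r_def)
  have one: "q (k + r) = q k" if "k \<ge> i" for k
    using that by (induction k rule: dec_induct) (use r q ij(1) in auto)
  have mult: "q (k + n * r) = q k" if "k \<ge> i" for k n
  proof (induction n)
    case (Suc n)
    then show ?case using one[of "k + n * r"] that by (simp add: algebra_simps)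
  qed simp
  have "r dvd fact (card S)" using r by (intro dvd_fact) auto
  then obtain n where "fact (card S) = n * r" by (metis dvd_def mult.commute)
  with mult show ?thesis by (auto simp: eventually_sequentially)
qed

text \<open>A push moves cell \<open>i\<close> to cell \<open>Suc i\<close>, so a late push carries
  the agreement one cell deeper, and later steps preserve it. If no push occurs any more, the tape
  is frozen.\<close>

lemma output_tape_eventually_periodic:
  assumes step: "\<And>k. u (Suc k) = tape_step (\<omega> k) (u k)"
    and out: "\<And>k. \<omega> k \<noteq> Pop"
    and \<omega>: "\<forall>\<^sub>F k in sequentially. \<omega> (k + M) = \<omega> k"
    and top: "\<forall>\<^sub>F k in sequentially. u (k + M) 0 = u k 0"
  shows "\<forall>\<^sub>F k in sequentially. u (k + M) i = u k i"
proof (induction i)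
  case (Suc i)
  obtain N where N: "\<And>k. k \<ge> N \<Longrightarrow> \<omega> (k + M) = \<omega> k" "\<And>k. k \<ge> N \<Longrightarrow> u (k + M) i = u k i"
    using eventually_conj[OF \<omega> Suc] unfolding eventually_sequentially by auto
  show ?case
  proof (cases "\<exists>k\<ge>N. \<exists>x. \<omega> k = Push x")
    case True
    then obtain k0 x where k0: "k0 \<ge> N" "\<omega> k0 = Push x" by blast
    have "u (k + M) (Suc i) = u k (Suc i)" if "k \<ge> Suc k0" for k
      using that
    proof (induction k rule: dec_induct)
      case base
      then show ?case using N[of k0] k0 by (simp add: step)
    next
      case (step k)
      then show ?case
        using N[of k] k0(1) out[of k] assms(1)[of k] assms(1)[of "k + M"] by (cases "\<omega> k") auto
    qed
    then show ?thesis by (auto simp: eventually_sequentially)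
  next
    case False
    then have stay: "\<omega> k = Stay" if "k \<ge> N" for k
      using that out[of k] by (cases "\<omega> k") auto
    have const: "u k = u N" if "k \<ge> N" for k
      using that by (induction k rule: dec_induct) (use stay step in auto)
    have "u (k + M) (Suc i) = u k (Suc i)" if "k \<ge> N" for k
      unfolding const[OF that] const[OF trans_le_add1[OF that]] ..
    then show ?thesis unfolding eventually_sequentially by blast
  qed
qed (use top in simp)

text \<open>An input tape is never written: its content is the initial one shifted by the number
  \<open>p k\<close> of pops so far. As this shift never decreases, it either reaches the constant
  tail or stops growing.\<close>

lemma input_tape_eventually_constant:
  assumes step: "\<And>k. u (Suc k) = tape_step (\<omega> k) (u k)"
    and inp: "\<And>k. \<omega> k \<in> {Stay, Pop}"
    and tail: "\<And>i. i \<ge> N \<Longrightarrow> u 0 i = d"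
  shows "\<exists>e. \<forall>\<^sub>F k in sequentially. u k i = e"
proof -
  define p where "p k = card {l. l < k \<and> \<omega> l = Pop}" for k
  have p_Suc: "p (Suc k) = (if \<omega> k = Pop then Suc (p k) else p k)" for k
  proof -
    have "{l. l < Suc k \<and> \<omega> l = Pop} =
        (if \<omega> k = Pop then insert k {l. l < k \<and> \<omega> l = Pop} else {l. l < k \<and> \<omega> l = Pop})"
      by (auto simp: less_Suc_eq)
    then show ?thesis by (simp add: p_def)
  qed
  have u: "u k i = u 0 (i + p k)" for k i
  proof (induction k arbitrary: i)
    case (Suc k)
    then show ?case using inp[of k] by (auto simp: step p_Suc)
  qed (simp add: p_def)
  show ?thesis
    unfolding u[of _ i] by (rule eventually_constant_comp_mono[of "\<lambda>k. i + p k" N]) (simp_all add: p_Suc tail)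
qed

text \<open>Once the heads of the input tapes have settled, the next state is a function of the
  current one, so the state becomes periodic. The operations on the output tapes then repeat with
  the same period.\<close>

lemma automaton_orbit_eventually_periodic:
  assumes fa: "finite_automaton T A \<delta>"
    and x: "x \<in> topspace (automaton_space T A)"
    and tail: "\<And>t i. t \<in> T \<Longrightarrow> i \<ge> N \<Longrightarrow> x t i = d t"
    and "t \<in> T"
  shows "\<forall>\<^sub>F k in sequentially.
    (automaton_map T \<delta> ^^ (k + fact (card (states T A)))) x t i = (automaton_map T \<delta> ^^ k) x t i"
proof -
  let ?f = "automaton_map T \<delta>" and ?M = "fact (card (states T A)) :: nat"
  define q where "q k = (\<lambda>r\<in>T. (?f ^^ k) x r 0)" for k
  have aut: "automaton T A \<delta>" using fa by (simp add: finite_automaton_def)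
  have orb: "(?f ^^ k) x \<in> topspace (automaton_space T A)" for k
    by (rule funpow_mem) (use x automaton_map_in_space[OF aut] in auto)
  have q_states: "q k \<in> states T A" for k
    using orb[of k]
    by (auto simp: q_def states_def topspace_automaton_space seq_space_def PiE_iff)
  have fin: "finite (states T A)"
    using aut by (auto simp: states_def automaton_def intro: finite_PiE)
  have step: "(?f ^^ Suc k) x t = tape_step (\<delta> t (q k)) ((?f ^^ k) x t)" if "t \<in> T" for t k
    using that by (simp add: automaton_map_def q_def)
  have input: "\<exists>e. \<forall>\<^sub>F k in sequentially. (?f ^^ k) x t i = e"
    if "t \<in> T" "input_tape T A \<delta> t" for t i
    using input_tape_eventually_constant[of "\<lambda>k. (?f ^^ k) x t" "\<lambda>k. \<delta> t (q k)" N "d t"]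
      step[OF that(1)] that q_states tail by (simp add: input_tape_def)
  define e where "e t = (SOME e. \<forall>\<^sub>F k in sequentially. (?f ^^ k) x t 0 = e)" for t
  have e: "\<forall>\<^sub>F k in sequentially. (?f ^^ k) x t 0 = e t" if "t \<in> T" "input_tape T A \<delta> t" for t
    unfolding e_def using input[OF that] by (rule someI_ex)
  \<comment> \<open>The new head of an output tape is the letter pushed or the old head. The branch
    \<open>_\<close> stands for \<open>Stay\<close> there, since \<open>noPop\<close> excludes
    \<open>Pop\<close>.\<close>
  define F where "F q = (\<lambda>t\<in>T. if input_tape T A \<delta> t then e t else
      (case \<delta> t q of Push y \<Rightarrow> y | _ \<Rightarrow> q t))" for q
  \<comment> \<open>As \<open>T\<close> is finite, one time \<open>L\<close> serves all input
    tapes.\<close>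
  have "\<forall>\<^sub>F k in sequentially. \<forall>t\<in>{t \<in> T. input_tape T A \<delta> t}. (?f ^^ k) x t 0 = e t"
    using aut e by (subst eventually_ball_finite_distrib) (auto simp: automaton_def)
  then obtain L where L: "\<And>k t. k \<ge> L \<Longrightarrow> t \<in> T \<Longrightarrow> input_tape T A \<delta> t \<Longrightarrow> (?f ^^ k) x t 0 = e t"
    unfolding eventually_sequentially by blast
  have noPop: "\<delta> t (q k) \<noteq> Pop" if "t \<in> T" "\<not> input_tape T A \<delta> t" for t k
  proof -
    have "output_tape T A \<delta> t" using fa that by (auto simp: finite_automaton_def)
    then show ?thesis using q_states[of k] by (auto simp: output_tape_def)
  qed
  have "q (Suc k) = F (q k)" if "k \<ge> L" for k
  proof
    fix t
    show "q (Suc k) t = F (q k) t"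
    proof (cases "t \<in> T")
      case True
      show ?thesis
      proof (cases "input_tape T A \<delta> t")
        case True
        then show ?thesis using L[of "Suc k" t] \<open>t \<in> T\<close> that by (simp add: q_def F_def)
      next
        case False
        have "q (Suc k) t = tape_step (\<delta> t (q k)) ((?f ^^ k) x t) 0"
          using step[OF \<open>t \<in> T\<close>, of k] \<open>t \<in> T\<close> by (simp add: q_def)
        moreover have "(?f ^^ k) x t 0 = q k t" using \<open>t \<in> T\<close> by (simp add: q_def)
        ultimately show ?thesis
          using noPop[OF \<open>t \<in> T\<close> False, of k] \<open>t \<in> T\<close> False
          by (cases "\<delta> t (q k)") (simp_all add: F_def)
      qed
    qed (simp add: q_def F_def)
  qed
  then have per: "\<forall>\<^sub>F k in sequentially. q (k + ?M) = q k"
    by (rule iterates_eventually_periodic[OF fin q_states])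
  show ?thesis
  proof (cases "input_tape T A \<delta> t")
    case True
    then obtain e' where "\<forall>\<^sub>F k in sequentially. (?f ^^ k) x t i = e'"
      using input \<open>t \<in> T\<close> by blast
    then obtain K where "\<And>k. k \<ge> K \<Longrightarrow> (?f ^^ k) x t i = e'"
      unfolding eventually_sequentially by blast
    then show ?thesis by (auto simp: eventually_sequentially intro!: exI[of _ K])
  next
    case False
    show ?thesis
    proof (rule output_tape_eventually_periodic[of "\<lambda>k. (?f ^^ k) x t" "\<lambda>k. \<delta> t (q k)"])
      show "\<forall>\<^sub>F k in sequentially. \<delta> t (q (k + ?M)) = \<delta> t (q k)"
        using per by (rule eventually_mono) simp
      show "\<forall>\<^sub>F k in sequentially. (?f ^^ (k + ?M)) x t 0 = (?f ^^ k) x t 0"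
        using per by (rule eventually_mono) (use \<open>t \<in> T\<close> in \<open>auto simp: q_def dest: fun_cong[of _ _ t]\<close>)
    qed (use step noPop \<open>t \<in> T\<close> False in auto)
  qed
qed

text \<open>Sampling at multiples of the common period makes each cell eventually constant, and the
  final letters form the limit.\<close>

lemma automaton_orbit_converges:
  assumes fa: "finite_automaton T A \<delta>"
    and x: "x \<in> topspace (automaton_space T A)"
    and tail: "\<And>t i. t \<in> T \<Longrightarrow> i \<ge> N \<Longrightarrow> x t i = d t"
  shows "\<exists>z. limitin (automaton_space T A)
    (\<lambda>n. (automaton_map T \<delta> ^^ (n * fact (card (states T A)))) x) z sequentially"
proof -
  let ?f = "automaton_map T \<delta>" and ?M = "fact (card (states T A)) :: nat"
  have aut: "automaton T A \<delta>" using fa by (simp add: finite_automaton_def)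
  have orb: "(?f ^^ k) x \<in> topspace (automaton_space T A)" for k
    by (rule funpow_mem) (use x automaton_map_in_space[OF aut] in auto)
  have "\<exists>L. \<forall>n\<ge>L. (?f ^^ (n * ?M)) x t i = (?f ^^ (L * ?M)) x t i" if t: "t \<in> T" for t i
  proof -
    obtain L where L: "\<And>k. k \<ge> L \<Longrightarrow> (?f ^^ (k + ?M)) x t i = (?f ^^ k) x t i"
      using automaton_orbit_eventually_periodic[OF fa x, of N d t i] tail t
      unfolding eventually_sequentially by blast
    have "(?f ^^ (n * ?M)) x t i = (?f ^^ (L * ?M)) x t i" if "n \<ge> L" for n
      using that
    proof (induction n rule: dec_induct)
      case (step n)
      \<comment> \<open>The period is at least \<open>1\<close>, so a threshold for times also
        serves for the number of periods.\<close>
      have "n * 1 \<le> n * ?M" by (intro mult_le_mono2) (simp add: Suc_le_eq)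
      then have "n * ?M \<ge> L" using step(1) by linarith
      then show ?case using L[of "n * ?M"] step by (simp add: add.commute)
    qed simp
    then show ?thesis by blast
  qed
  then obtain L where L: "\<And>t i n. t \<in> T \<Longrightarrow> n \<ge> L t i \<Longrightarrow>
      (?f ^^ (n * ?M)) x t i = (?f ^^ (L t i * ?M)) x t i"
    by metis
  \<comment> \<open>Each cell is read at its own threshold \<open>L t i\<close>, which suffices for
    cellwise convergence.\<close>
  define z where "z = (\<lambda>t\<in>T. \<lambda>i. (?f ^^ (L t i * ?M)) x t i)"
  have "limitin (automaton_space T A) (\<lambda>n. (?f ^^ (n * ?M)) x) z sequentially"
  proof (rule limitin_automaton_space[OF orb])
    show "z \<in> topspace (automaton_space T A)"
      using orb by (fastforce simp: topspace_automaton_space z_def seq_space_def PiE_iff)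
    show "\<forall>\<^sub>F n in sequentially. (?f ^^ (n * ?M)) x t i = z t i" if "t \<in> T" for t i
    proof -
      have "z t i = (?f ^^ (L t i * ?M)) x t i" using that by (simp add: z_def)
      then show ?thesis
        unfolding eventually_sequentially by (auto intro!: exI[of _ "L t i"] L[OF that])
    qed
  qed
  then show ?thesis by (rule exI[of _ z])
qed

section \<open>Dense convergent points in a factor\<close>

lemma dense_constant_tails:
  assumes "x \<in> topspace (automaton_space T A)"
  shows "\<exists>y. (\<forall>N. y N \<in> topspace (automaton_space T A) \<and> (\<forall>t\<in>T. \<forall>i\<ge>N. y N t i = x t 0)) \<and>
    limitin (automaton_space T A) y x sequentially"
proof (intro exI conjI allI)
  \<comment> \<open>The filler \<open>x t 0\<close> is a letter of \<open>A t\<close>, so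
    \<open>y N\<close> stays in the space.\<close>
  define y where "y N = (\<lambda>t\<in>T. \<lambda>i. if i < N then x t i else x t 0)" for N
  show y: "y N \<in> topspace (automaton_space T A)" for N
    using assms by (auto simp: y_def topspace_automaton_space seq_space_def PiE_iff)
  show "\<forall>t\<in>T. \<forall>i\<ge>N. y N t i = x t 0" for N by (simp add: y_def)
  show "limitin (automaton_space T A) y x sequentially"
  proof (rule limitin_automaton_space[OF y assms])
    show "\<forall>\<^sub>F n in sequentially. y n t i = x t i" if "t \<in> T" for t i
      using eventually_gt_at_top[of i] by (rule eventually_mono) (simp add: y_def that)
  qed
qed

text \<open>Lift a point of \<open>U\<close> to the automaton and approximate the lift by points
  with constant tails. Continuity of the factor map keeps their images in \<open>U\<close> and
  transports the convergence. The exponent depends only on the automaton, not on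
  \<open>U\<close>.\<close>

lemma factor_dense_convergent:
  fixes g :: "real \<Rightarrow> real"
  assumes fa: "finite_automaton T A \<delta>"
    and factor: "factor_of (top_of_set {a..b}) g (automaton_space T A) (automaton_map T \<delta>)"
    and U: "open U" "U \<inter> {a..b} \<noteq> {}"
  shows "\<exists>y\<in>U \<inter> {a..b}. \<exists>\<zeta>\<in>{a..b}. (\<lambda>n. (g ^^ (n * fact (card (states T A)))) y) \<longlonglongrightarrow> \<zeta>"
proof -
  let ?X = "automaton_space T A" and ?f = "automaton_map T \<delta>"
  let ?M = "fact (card (states T A)) :: nat"
  obtain \<phi> where \<phi>: "continuous_map ?X (top_of_set {a..b}) \<phi>" "\<phi> ` topspace ?X = {a..b}"
    "\<And>x. x \<in> topspace ?X \<Longrightarrow> g (\<phi> x) = \<phi> (?f x)"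
    using factor by (auto simp: factor_of_def)
  have aut: "automaton T A \<delta>" using fa by (simp add: finite_automaton_def)
  have orb: "(?f ^^ k) x \<in> topspace ?X" if "x \<in> topspace ?X" for k x
    by (rule funpow_mem) (use that automaton_map_in_space[OF aut] in auto)
  have semi: "(g ^^ k) (\<phi> x) = \<phi> ((?f ^^ k) x)" if "x \<in> topspace ?X" for k x
    by (induction k) (use \<phi>(3) orb[OF that] in auto)
  have lim: "(\<lambda>n. \<phi> (u n)) \<longlonglongrightarrow> \<phi> x \<and> \<phi> x \<in> {a..b}" if "limitin ?X u x sequentially" for u x
    using continuous_map_limit[OF \<phi>(1) that] by (simp add: limitin_subtopology o_def)
  have "U \<inter> \<phi> ` topspace ?X \<noteq> {}" unfolding \<phi>(2) by (rule U(2))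
  then obtain x where x: "x \<in> topspace ?X" "\<phi> x \<in> U" by blast
  obtain y where tails: "\<forall>N. y N \<in> topspace ?X \<and> (\<forall>t\<in>T. \<forall>i\<ge>N. y N t i = x t 0)"
    and y_lim: "limitin ?X y x sequentially"
    using dense_constant_tails[OF x(1)] by (elim exE conjE)
  then have y: "\<And>N. y N \<in> topspace ?X" "\<And>N t i. t \<in> T \<Longrightarrow> i \<ge> N \<Longrightarrow> y N t i = x t 0"
    by simp_all
  have "\<forall>\<^sub>F N in sequentially. \<phi> (y N) \<in> U"
    using lim[OF y_lim] U(1) x(2) by (auto intro: topological_tendstoD)
  then obtain N where N: "\<phi> (y N) \<in> U" by (auto simp: eventually_sequentially)
  obtain z where "limitin ?X (\<lambda>n. (?f ^^ (n * ?M)) (y N)) z sequentially"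
    using automaton_orbit_converges[OF fa y(1) y(2)] by (rule exE)
  from lim[OF this] have "(\<lambda>n. (g ^^ (n * ?M)) (\<phi> (y N))) \<longlonglongrightarrow> \<phi> z" "\<phi> z \<in> {a..b}"
    by (simp_all add: semi[OF y(1)])
  moreover have "\<phi> (y N) \<in> {a..b}" using imageI[OF y(1)] unfolding \<phi>(2)[symmetric] .
  ultimately show ?thesis using N by (intro bexI[of _ "\<phi> z"] bexI[of _ "\<phi> (y N)"] IntI)
qed

section \<open>Periodicity forced on the kneading sequence\<close>

theorem corollary2:
  fixes a b c :: real and g :: "real \<Rightarrow> real" and s :: "bool list"
    and T :: "'t set" and A :: "'t \<Rightarrow> 'a set"
    and \<delta> :: "'t \<Rightarrow> ('t \<Rightarrow> 'a) \<Rightarrow> 'a tape_op"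
  assumes "S_unimodal a b c g"
    and "odd_word s" and "aperiodic_word s" and "maximal_word s"
    and "kneading g c = doubling_limit s"
    and "finite_automaton T A \<delta>"
  shows "\<not> factor_of (top_of_set {a..b}) g (automaton_space T A) (automaton_map T \<delta>)"
proof
  assume factor: "factor_of (top_of_set {a..b}) g (automaton_space T A) (automaton_map T \<delta>)"
  let ?M = "fact (card (states T A)) :: nat"
  have g: "unimodal a b c g" using assms(1) by (simp add: S_unimodal_def)
  have self: "g ` {a..b} \<subseteq> {a..b}" and cont: "continuous_on {a..b} g"
    using g by (simp_all add: unimodal_def)
  have cont_pow: "continuous_on {a..b} (g ^^ n)" for n
  proof (induction n)
    case (Suc n)
    have "(g ^^ n) ` {a..b} \<subseteq> {a..b}" using funpow_mem[OF self] by blast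
    then show ?case
      using continuous_on_compose[OF Suc continuous_on_subset[OF cont]] by simp
  qed (simp add: id_def)
  have s: "s \<noteq> []" using assms(2) by (auto simp: odd_word_def)
  have c: "(g ^^ M) c \<noteq> c" if "M > 0" for M
    using doubling_limit_not_periodic[OF s that] kneading_periodic[OF _ that, of g c] assms(5)
    by auto
  have "kneading g c (i + ?M) = kneading g c i" for i
  proof -
    \<comment> \<open>The scale is taken so large that position \<open>i + ?M\<close> lies below
      \<open>m - 1\<close>, where the hulls control the sides.\<close>
    obtain k where k: "Suc (i + ?M) < 2 ^ k" using less_exp by blast
    define m where "m = length s * 2 ^ k"
    have "1 * 2 ^ k \<le> m" unfolding m_def using s by (intro mult_le_mono1) (simp add: Suc_le_eq)
    then have m: "Suc (i + ?M) < m" using k by simp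
    then have "m > 0" by simp
    have K: "\<And>i. i mod m \<noteq> m - 1 \<Longrightarrow> kneading g c i = kneading g c (i mod m)"
      unfolding assms(5) by (rule doubling_limit_mod[OF s m_def])
    let ?S = "orbit_class g c m 0"
    have closed_hull: "closed (order_hull ?S)" by (simp add: order_hull_def)
    have hull: "order_hull ?S \<subseteq> {a..b}"
      by (rule order_hull_subset[OF _ orbit_class_subset[OF g]]) (simp add: orbit_class_def)
    \<comment> \<open>\<open>c\<close> and \<open>(g ^^ m) c\<close> are distinct points of the
      class, so its hull has nonempty interior and density supplies a point \<open>y\<close>
      there.\<close>
    have "(g ^^ (0 + 0 * m)) c \<in> ?S" "(g ^^ (0 + 1 * m)) c \<in> ?S"
      unfolding orbit_class_def by blast+
    then have "c \<in> order_hull ?S" "(g ^^ m) c \<in> order_hull ?S"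
      using closure_subset closure_subset_order_hull[OF orbit_class_subset[OF g]] by fastforce+
    then have "Inf ?S < Sup ?S" using c[OF \<open>m > 0\<close>] by (auto simp: order_hull_def)
    then obtain u where "u \<in> {Inf ?S<..<Sup ?S}" using dense by auto
    then have ne: "{Inf ?S<..<Sup ?S} \<inter> {a..b} \<noteq> {}" using hull by (fastforce simp: order_hull_def)
    obtain y \<zeta> where "y \<in> {Inf ?S<..<Sup ?S} \<inter> {a..b}" and \<zeta>: "\<zeta> \<in> {a..b}"
      and lim: "(\<lambda>n. (g ^^ (n * ?M)) y) \<longlonglongrightarrow> \<zeta>"
      using factor_dense_convergent[OF assms(6) factor open_greaterThanLessThan ne]
      by (elim bexE)
    then have y: "y \<in> order_hull ?S" by (simp add: order_hull_def)
    have orb: "(g ^^ n) y \<in> {a..b}" for n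
      using funpow_mem[OF self, of y n] y hull by blast
    have "(\<lambda>n. (g ^^ ?M) ((g ^^ (n * ?M)) y)) \<longlonglongrightarrow> (g ^^ ?M) \<zeta>"
      using continuous_on_tendsto_compose[OF cont_pow lim \<zeta>] orb by simp
    moreover have "(\<lambda>n. (g ^^ ?M) ((g ^^ (n * ?M)) y)) \<longlonglongrightarrow> \<zeta>"
      using LIMSEQ_Suc[OF lim] by (simp add: funpow_add)
    ultimately have fixed: "(g ^^ ?M) \<zeta> = \<zeta>" by (rule LIMSEQ_unique)
    \<comment> \<open>At times divisible by \<open>m\<close> the iterates of \<open>y\<close> return
      to the hull around \<open>c\<close>. This subsequence has the same limit \<zeta>, which the
      closed hull must contain.\<close>
    have sublim: "(\<lambda>n. (g ^^ (n * m * ?M)) y) \<longlonglongrightarrow> \<zeta>"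
      using LIMSEQ_subseq_LIMSEQ[OF lim, of "\<lambda>n. n * m"] \<open>m > 0\<close>
      by (simp add: o_def strict_mono_def)
    have "(g ^^ (n * m * ?M)) y \<in> order_hull ?S" for n
      using funpow_order_hull[OF g \<open>m > 0\<close> K y, of "n * m * ?M"] by simp
    from closed_sequentially[OF closed_hull this sublim]
    have "\<zeta> \<in> order_hull ?S" .
    then show ?thesis
      using kneading_periodic_of_fixed_point[OF g \<open>m > 0\<close> K _ fixed c[OF fact_gt_zero] m] by blast
  qed
  then show False
    using doubling_limit_not_periodic[OF s, of ?M] assms(5) by simp
qed

end
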